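(* Let $\Omega\subset\mathbb R^n$ be a Borel set, and let $C$ be either a nonempty closed set $C\subset\overline\Omega$ with $\mathcal L^n(C\cap\Omega)=0$, or $C=\{\infty\}$. Let $E\subset\Omega$ be a Borel set and assume that for each $r>0$ $$\mathcal L^n\big(C_\delta\cap E\cap B_r(\infty)\big)>0\qquad\text{for all }\delta>0 .$$ Then there exists a density measure $\mu\in\mathrm{Dens}_C$ on $\Omega$ such that $\operatorname{core}\mu=\{\infty\}$ and $E$ is an aura of $\mu$.
   Context: $\mathcal L^n$ is Lebesgue measure and $\mathcal B(\Omega)$ the Borel subsets of $\Omega$. $\mathrm{ba}(\Omega,\mathcal B(\Omega),\mathcal L^n)$ is the space of bounded finitely additive set functions $\mu:\mathcal B(\Omega)\to\mathbb R$ with $\mu(A)=0$ whenever $\mathcal L^n(A)=0$; $|\mu|$ is the total variation. $\overline\Omega$ is the closure in $\mathbb R^n$, and $\mathbb R^n\cup\{\infty\}$ is the one-point compactification with $B_r(\infty)=\{\infty\}\cup\{y\in\mathbb R^n:|y|>1/r\}$ for $r>0$. $C_\delta$ is the open $\delta$-neighborhood of $C$ if $C\subset\overline\Omega$, and $\{\infty\}_\delta:=B_\delta(\infty)$. $\mathrm{Dens}_C$ (density measures at $C$ on $\Omega$) is the set of all $\mu\in\mathrm{ba}(\Omega,\mathcal B(\Omega),\mathcal L^n)$ with $\mu\ge0$ and $\mu(C_\delta\cap\Omega)=\mu(\Omega)=1$ for all $\delta>0$. $\operatorname{core}\mu$ is the set of all $x\in\mathbb R^n\cup\{\infty\}$ such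 that $|\mu|(U\cap\Omega)>0$ for every open $U\subset\mathbb R^n\cup\{\infty\}$ with $x\in U$. A set $E\in\mathcal B(\Omega)$ is an aura of $\mu$ if $|\mu|(\Omega\setminus E)=0$. *)

theory Defs
  imports "HOL-Analysis.Analysis"
begin

text \<open>
  The one-point compactification of \<open>\<real>\<^sup>n\<close> is the library's Alexandroff compactification, whose
  carrier is the option type: \<open>Some x\<close> is the point \<open>x\<close> and \<open>None\<close> is \<open>\<infinity>\<close>. For a set \<open>U\<close> of points
  of the compactification, \<open>U \<inter> \<Omega>\<close> is written \<open>Some -` U \<inter> \<Omega>\<close>.
\<close>

abbreviation cpt_space :: "(real ^ 'n) option topology" where
  "cpt_space \<equiv> Alexandroff_compactification euclidean"

definition ball_infty :: "real \<Rightarrow> (real ^ 'n) option set" where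
  "ball_infty r = insert None (Some ` {y. norm y > 1 / r})"

text \<open>
  Only used for \<open>C = {None}\<close> and for \<open>C = Some ` K\<close> with \<open>K\<close> a nonempty set of points of \<open>\<real>\<^sup>n\<close>.
\<close>

definition nbhd :: "(real ^ 'n) option set \<Rightarrow> real \<Rightarrow> (real ^ 'n) option set" where
  "nbhd C \<delta> =
     (if C = {None} then ball_infty \<delta>
      else Some ` {x. \<exists>c. Some c \<in> C \<and> dist x c < \<delta>})"

abbreviation borel_subsets :: "(real ^ 'n) set \<Rightarrow> (real ^ 'n) set set" where
  "borel_subsets \<Omega> \<equiv> sets (restrict_space borel \<Omega>)"

text \<open>
  A set function on the Borel subsets of \<open>\<Omega>\<close> is a total function on all sets whose values outside
  \<open>borel_subsets \<Omega>\<close> are irrelevant: they enter none of the notions below.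
\<close>

definition ba_space :: "(real ^ 'n) set \<Rightarrow> ((real ^ 'n) set \<Rightarrow> real) set" where
  "ba_space \<Omega> = {\<mu>.
     Measure_Space.additive (borel_subsets \<Omega>) \<mu> \<and>
     bounded (\<mu> ` borel_subsets \<Omega>) \<and>
     (\<forall>A\<in>borel_subsets \<Omega>. emeasure lborel A = 0 \<longrightarrow> \<mu> A = 0)}"

text \<open>
  The supremum is over a nonempty set which is bounded above whenever \<open>\<mu> \<in> ba_space \<Omega>\<close> and
  \<open>A \<in> borel_subsets \<Omega>\<close>, so the real-valued \<open>Sup\<close> is meaningful there.
\<close>

definition total_var ::
  "(real ^ 'n) set \<Rightarrow> ((real ^ 'n) set \<Rightarrow> real) \<Rightarrow> (real ^ 'n) set \<Rightarrow> real" where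
  "total_var \<Omega> \<mu> A =
     (SUP P \<in> {P. finite P \<and> P \<subseteq> borel_subsets \<Omega> \<and> partition_on A P}. \<Sum>B\<in>P. \<bar>\<mu> B\<bar>)"

definition Dens ::
  "(real ^ 'n) set \<Rightarrow> (real ^ 'n) option set \<Rightarrow> ((real ^ 'n) set \<Rightarrow> real) set" where
  "Dens \<Omega> C = {\<mu> \<in> ba_space \<Omega>.
     (\<forall>A\<in>borel_subsets \<Omega>. \<mu> A \<ge> 0) \<and>
     (\<forall>\<delta>>0. \<mu> (Some -` nbhd C \<delta> \<inter> \<Omega>) = \<mu> \<Omega> \<and> \<mu> \<Omega> = 1)}"

definition core ::
  "(real ^ 'n) set \<Rightarrow> ((real ^ 'n) set \<Rightarrow> real) \<Rightarrow> (real ^ 'n) option set" where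
  "core \<Omega> \<mu> = {x. \<forall>U. openin cpt_space U \<and> x \<in> U \<longrightarrow> total_var \<Omega> \<mu> (Some -` U \<inter> \<Omega>) > 0}"

definition is_aura ::
  "(real ^ 'n) set \<Rightarrow> ((real ^ 'n) set \<Rightarrow> real) \<Rightarrow> (real ^ 'n) set \<Rightarrow> bool" where
  "is_aura \<Omega> \<mu> E \<longleftrightarrow> E \<in> borel_subsets \<Omega> \<and> total_var \<Omega> \<mu> (\<Omega> - E) = 0"

end

theory Submission
  imports Defs
begin

text \<open>
  The sets \<open>C\<^sub>\<delta> \<inter> E \<inter> B\<^sub>\<delta>(\<infinity>)\<close> decrease as \<open>\<delta>\<close> decreases and have positive measure. The measure
  \<open>\<mu>\<close> is a cluster point, in the product topology of \<open>[0, 1]\<close>-valued set functions (compact by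
  Tychonoff), of Lebesgue measure conditioned on subsets of finite positive measure of these sets
  for \<open>\<delta> = 1, 1/2, 1/3, \<dots>\<close>. So \<open>\<mu>\<close> has value 1 on every set that contains one of them and
  value 0 on every set that misses one of them.
\<close>

section \<open>Finitely additive limits of conditional measures\<close>

text \<open>Countably many sets of finite measure cover the space, and their traces on
  \<open>A\<close> cannot all be null. The finite measure obtained serves as a denominator for
  conditioning.\<close>

lemma (in sigma_finite_measure) positive_finite_subset:
  assumes "A \<in> sets M" "emeasure M A > 0"
  obtains B where "B \<in> sets M" "B \<subseteq> A" "emeasure M B > 0" "emeasure M B < \<infinity>"
proof -
  obtain S :: "nat \<Rightarrow> 'a set" where S: "range S \<subseteq> sets M" "(\<Union>i. S i) = space M"
      "\<And>i. emeasure M (S i) \<noteq> \<infinity>"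
    using sigma_finite by metis
  have "\<exists>i. emeasure M (A \<inter> S i) \<noteq> 0"
  proof (rule ccontr)
    assume "\<not> ?thesis"
    then have "A \<inter> S i \<in> null_sets M" for i
      using assms(1) S(1) by (auto simp: null_sets_def)
    then have "(\<Union>i. A \<inter> S i) \<in> null_sets M"
      by (intro null_sets_UN) auto
    moreover have "(\<Union>i. A \<inter> S i) = A"
      using S(2) sets.sets_into_space[OF assms(1)] by blast
    ultimately show False
      using assms(2) by auto
  qed
  then obtain i where i: "emeasure M (A \<inter> S i) \<noteq> 0"
    by blast
  have "emeasure M (A \<inter> S i) \<le> emeasure M (S i)"
    using S(1) by (intro emeasure_mono) auto
  then have "emeasure M (A \<inter> S i) < \<infinity>"
    using S(3)[of i] by (auto simp: top_unique less_top)
  then show thesis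
    using i assms(1) S(1) that[of "A \<inter> S i"] by (auto simp: zero_less_iff_neq_zero)
qed

text \<open>This is Tychonoff's theorem for a power of the unit interval: the topology on the
  function type is the product topology.\<close>

lemma compact_unit_valued_functions:
  "compact {f :: 'a \<Rightarrow> real. \<forall>x. 0 \<le> f x \<and> f x \<le> 1}"
proof -
  have "compactin (product_topology (\<lambda>_. euclideanreal) UNIV) (PiE UNIV (\<lambda>_::'a. {0..1::real}))"
    by (simp add: compactin_PiE)
  then show ?thesis
    by (simp add: euclidean_product_topology PiE_UNIV_domain Pi_def)
qed

text \<open>The bounds and the last two properties hold for arbitrary \<open>A\<close>:
  \<open>measure\<close> is 0 on nonmeasurable sets, and in the last two cases \<open>A\<close>
  eventually meets the conditioning sets in everything or in nothing.\<close>

lemma (in sigma_finite_measure) finitely_additive_limit: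
  fixes F :: "nat \<Rightarrow> 'a set"
  assumes F: "\<And>n. F n \<in> sets M" "\<And>n. emeasure M (F n) > 0" "decseq F"
  obtains \<mu> :: "'a set \<Rightarrow> real" where "Measure_Space.additive (sets M) \<mu>"
    "\<And>A. 0 \<le> \<mu> A" "\<And>A. \<mu> A \<le> 1"
    "\<And>A. A \<in> sets M \<Longrightarrow> emeasure M A = 0 \<Longrightarrow> \<mu> A = 0"
    "\<And>A n. F n \<subseteq> A \<Longrightarrow> \<mu> A = 1" "\<And>A n. A \<inter> F n = {} \<Longrightarrow> \<mu> A = 0"
proof -
  have "\<forall>n. \<exists>B. B \<in> sets M \<and> B \<subseteq> F n \<and> emeasure M B > 0 \<and> emeasure M B < \<infinity>"
    using positive_finite_subset F by metis
  then obtain G where G: "\<And>n. G n \<in> sets M" "\<And>n. G n \<subseteq> F n"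
      "\<And>n. emeasure M (G n) > 0" "\<And>n. emeasure M (G n) < \<infinity>"
    by metis
  define p where "p n A = measure M (A \<inter> G n) / measure M (G n)" for n A
  have fm: "G n \<in> fmeasurable M" for n
    using G by (auto intro: fmeasurableI)
  have pos: "measure M (G n) > 0" for n
    using G by (simp add: measure_def enn2real_positive_iff)
  have p01: "0 \<le> p n A" "p n A \<le> 1" for n A
  proof -
    show "0 \<le> p n A" by (simp add: p_def)
    have "measure M (A \<inter> G n) \<le> measure M (G n)"
    proof (cases "A \<inter> G n \<in> sets M")
      case True
      then show ?thesis using fm by (intro measure_mono_fmeasurable) auto
    qed (simp add: measure_notin_sets)
    then show "p n A \<le> 1" using pos by (simp add: p_def)
  qed
  let ?K = "{f :: 'a set \<Rightarrow> real. \<forall>x. 0 \<le> f x \<and> f x \<le> 1}"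
  let ?L = "filtermap p sequentially"
  have "?L \<noteq> bot" "eventually (\<lambda>f. f \<in> ?K) ?L"
    using p01 by (auto simp: filtermap_bot_iff eventually_filtermap)
  then obtain \<mu> where \<mu>: "\<mu> \<in> ?K" and nb: "inf (nhds \<mu>) ?L \<noteq> bot"
    using compact_unit_valued_functions[unfolded compact_filter] by blast
  \<comment> \<open>\<open>?H\<close> refines both \<open>nhds \<mu>\<close> and the tail filter of
    \<open>p\<close>, so it acts as a subnet of \<open>p\<close> converging to
    \<open>\<mu>\<close>.\<close>
  let ?H = "inf (nhds \<mu>) ?L"
  \<comment> \<open>Evaluation at \<open>A\<close> is a coordinate projection, hence
    continuous.\<close>
  have lim: "((\<lambda>f. f A) \<longlongrightarrow> \<mu> A) ?H" for A
  proof (rule filterlim_mono[OF _ order_refl inf_le1])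
    have "continuous_on UNIV (\<lambda>f :: 'a set \<Rightarrow> real. f A)"
      by (rule continuous_on_product_coordinates)
    then show "((\<lambda>f. f A) \<longlongrightarrow> \<mu> A) (nhds \<mu>)"
      unfolding continuous_on_def using tendsto_at_iff_tendsto_nhds by blast
  qed
  \<comment> \<open>What holds for almost all \<open>n\<close> holds eventually along
    \<open>?H\<close>, and limits along this nontrivial filter are unique.\<close>
  have limit_eq: "\<mu> A = c" if "eventually (\<lambda>n. p n A = c) sequentially" for A c
  proof (rule tendsto_unique[OF nb lim])
    have "eventually (\<lambda>f. f A = c) ?H"
      using that by (intro filter_leD[OF inf_le2]) (simp add: eventually_filtermap)
    then show "((\<lambda>f. f A) \<longlongrightarrow> c) ?H"
      by (rule tendsto_eventually)
  qed
  have mono: "G m \<subseteq> F n" if "m \<ge> n" for m n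
    using G(2)[of m] F(3) that by (auto dest: decseqD)
  show thesis
  proof
    show "0 \<le> \<mu> A" "\<mu> A \<le> 1" for A
      using \<mu> by auto
    show "Measure_Space.additive (sets M) \<mu>"
      unfolding Measure_Space.additive_def
    proof (intro ballI impI)
      fix A B assume AB: "A \<in> sets M" "B \<in> sets M" "A \<inter> B = {}"
      have "p n (A \<union> B) = p n A + p n B" for n
      proof -
        have "measure M ((A \<inter> G n) \<union> (B \<inter> G n)) = measure M (A \<inter> G n) + measure M (B \<inter> G n)"
        proof (rule measure_Un_AE)
          show "A \<inter> G n \<in> fmeasurable M" "B \<inter> G n \<in> fmeasurable M"
            using AB G(1) fm by (auto intro: fmeasurableI2[OF fm[of n]])
        qed (use AB in auto)
        then show ?thesis
          by (simp add: p_def Int_Un_distrib2 add_divide_distrib)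
      qed
      \<comment> \<open>Additivity of every \<open>p n\<close> passes to the limit because addition
        is continuous.\<close>
      then have "eventually (\<lambda>f. f A + f B = f (A \<union> B)) ?H"
        by (intro filter_leD[OF inf_le2]) (simp add: eventually_filtermap)
      then have "((\<lambda>f. f (A \<union> B)) \<longlongrightarrow> \<mu> A + \<mu> B) ?H"
        using tendsto_add[OF lim[of A] lim[of B]] by (rule Lim_transform_eventually[rotated])
      then show "\<mu> (A \<union> B) = \<mu> A + \<mu> B"
        by (rule tendsto_unique[OF nb lim])
    qed
    show "\<mu> A = 0" if "A \<in> sets M" "emeasure M A = 0" for A
    proof (rule limit_eq, rule always_eventually, rule allI)
      fix n
      have "A \<inter> G n \<in> null_sets M"
        using that G(1) by (intro null_set_Int2) auto
      then show "p n A = 0"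
        by (simp add: p_def measure_def null_setsD1)
    qed
    show "\<mu> A = 1" if "F n \<subseteq> A" for A n
    proof (rule limit_eq, rule eventually_sequentiallyI)
      fix m assume "m \<ge> n"
      then have "A \<inter> G m = G m" using mono that by blast
      then show "p m A = 1" using pos[of m] by (simp add: p_def)
    qed
    show "\<mu> A = 0" if "A \<inter> F n = {}" for A n
    proof (rule limit_eq, rule eventually_sequentiallyI)
      fix m assume "m \<ge> n"
      then have "A \<inter> G m = {}" using mono that by blast
      then show "p m A = 0" by (simp add: p_def)
    qed
  qed
qed

section \<open>Total variation of nonnegative set functions\<close>

lemma additive_sum_disjoint:
  fixes \<mu> :: "'a set \<Rightarrow> real"
  assumes add: "Measure_Space.additive (sets M) \<mu>"
    and "finite P" "P \<subseteq> sets M" "disjoint P"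
  shows "(\<Sum>B\<in>P. \<mu> B) = \<mu> (\<Union>P)"
  using assms(2-)
proof (induction P rule: finite_induct)
  case empty
  \<comment> \<open>The empty set is disjoint from itself, so additivity alone forces
    \<open>\<mu> {} = 0\<close>.\<close>
  have "\<mu> ({} \<union> {}) = \<mu> {} + \<mu> {}"
    using add unfolding Measure_Space.additive_def by blast
  then show ?case by simp
next
  case (insert B P)
  have "B \<inter> \<Union>P = {}"
    using insert.hyps insert.prems by (auto simp: disjoint_def)
  moreover have "B \<in> sets M" "\<Union>P \<in> sets M"
    using insert.hyps insert.prems by auto
  ultimately have "\<mu> (B \<union> \<Union>P) = \<mu> B + \<mu> (\<Union>P)"
    using add unfolding Measure_Space.additive_def by blast
  then show ?case
    using insert by (simp add: pairwise_insert)
qed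

text \<open>Every admissible partition gives the same sum, so the supremum is over a
  singleton.\<close>

lemma total_var_nonneg:
  fixes \<mu> :: "(real ^ 'n) set \<Rightarrow> real"
  assumes add: "Measure_Space.additive (borel_subsets \<Omega>) \<mu>"
    and nonneg: "\<And>B. B \<in> borel_subsets \<Omega> \<Longrightarrow> \<mu> B \<ge> 0" and A: "A \<in> borel_subsets \<Omega>"
  shows "total_var \<Omega> \<mu> A = \<mu> A"
proof -
  let ?Q = "{P. finite P \<and> P \<subseteq> borel_subsets \<Omega> \<and> partition_on A P}"
  have eq: "(\<Sum>B\<in>P. \<bar>\<mu> B\<bar>) = \<mu> A" if "P \<in> ?Q" for P
  proof -
    have "(\<Sum>B\<in>P. \<bar>\<mu> B\<bar>) = (\<Sum>B\<in>P. \<mu> B)"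
      using that nonneg by (intro sum.cong) auto
    also have "\<dots> = \<mu> (\<Union>P)"
      using that additive_sum_disjoint[OF add] by (simp add: partition_on_def)
    finally show ?thesis
      using that by (simp add: partition_on_def)
  qed
  \<comment> \<open>The blocks in \<open>partition_on\<close> are nonempty, so the empty set has
    only the empty partition.\<close>
  have "(if A = {} then {} else {A}) \<in> ?Q"
    using A by (auto simp: partition_on_def)
  then have "?Q \<noteq> {}" by blast
  then have "(\<lambda>P. \<Sum>B\<in>P. \<bar>\<mu> B\<bar>) ` ?Q = {\<mu> A}"
    using eq by (auto simp: image_iff)
  then show ?thesis
    by (simp only: total_var_def cSup_singleton)
qed

section \<open>Neighborhoods of \<open>C\<close> and of infinity\<close>

lemma vimage_Some_ball_infty: "Some -` ball_infty r = {y. norm y > 1 / r}"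
  by (auto simp: ball_infty_def)

lemma open_vimage_ball_infty: "open (Some -` ball_infty r)"
  by (simp add: vimage_Some_ball_infty open_Collect_less continuous_on_norm_id)

text \<open>Openness is what makes the conditioning sets Borel.\<close>

lemma open_vimage_nbhd: "open (Some -` nbhd C \<delta>)"
proof (cases "C = {None}")
  case True
  then show ?thesis
    by (simp add: nbhd_def open_vimage_ball_infty)
next
  case False
  then have "Some -` nbhd C \<delta> = (\<Union>c\<in>{c. Some c \<in> C}. ball c \<delta>)"
    by (auto simp: nbhd_def inj_vimage_image_eq dist_commute)
  then show ?thesis by auto
qed

lemma ball_infty_mono: "0 < \<epsilon> \<Longrightarrow> \<epsilon> \<le> \<delta> \<Longrightarrow> ball_infty \<epsilon> \<subseteq> ball_infty \<delta>"
  unfolding ball_infty_def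
  using divide_left_mono[of \<epsilon> \<delta> 1]
  by (intro insert_mono image_mono Collect_mono) (simp add: order.strict_trans1)

lemma nbhd_mono: "0 < \<epsilon> \<Longrightarrow> \<epsilon> \<le> \<delta> \<Longrightarrow> nbhd C \<epsilon> \<subseteq> nbhd C \<delta>"
  unfolding nbhd_def using ball_infty_mono[of \<epsilon> \<delta>]
  by (cases "C = {None}") (simp_all, intro image_mono Collect_mono, fastforce)

section \<open>Construction of the density measure\<close>

theorem proposition3p7:
  fixes \<Omega> E :: "(real ^ 'n) set" and C :: "(real ^ 'n) option set"
  assumes "\<Omega> \<in> sets borel"
    and "(\<exists>K. C = Some ` K \<and> K \<noteq> {} \<and> closed K \<and> K \<subseteq> closure \<Omega> \<and>
            emeasure lborel (K \<inter> \<Omega>) = 0)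
         \<or> C = {None}"
    and "E \<subseteq> \<Omega>" and "E \<in> sets borel"
    and "\<And>r \<delta>. r > 0 \<Longrightarrow> \<delta> > 0 \<Longrightarrow>
           emeasure lborel (Some -` (nbhd C \<delta> \<inter> ball_infty r) \<inter> E) > 0"
  shows "\<exists>\<mu>\<in>Dens \<Omega> C. core \<Omega> \<mu> = {None} \<and> is_aura \<Omega> \<mu> E"
proof -
  define d :: "nat \<Rightarrow> real" where "d n = inverse (real (Suc n))" for n
  \<comment> \<open>One radius \<open>d n\<close> controls both factors, so a single decreasing
    sequence approaches \<open>C\<close> and escapes to infinity.\<close>
  define F where "F n = Some -` (nbhd C (d n) \<inter> ball_infty (d n)) \<inter> E" for n
  have d: "d n > 0" for n by (simp add: d_def)
  have bs: "A \<in> borel_subsets \<Omega> \<longleftrightarrow> A \<in> sets borel \<and> A \<subseteq> \<Omega>" for A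
    using assms(1) by (auto simp: sets_restrict_space_iff)
  have FB: "F n \<in> sets lborel" for n
    using open_vimage_nbhd[of C "d n"] open_vimage_ball_infty[of "d n"] assms(4)
    unfolding F_def vimage_Int by (auto intro: borel_open)
  have Fpos: "emeasure lborel (F n) > 0" for n
    unfolding F_def by (rule assms(5)[OF d d])
  have Fdec: "decseq F"
  proof (rule antimonoI)
    fix m n :: nat assume "m \<le> n"
    then have "d n \<le> d m" by (simp add: d_def)
    then show "F n \<subseteq> F m"
      using nbhd_mono[OF d] ball_infty_mono[OF d] by (force simp: F_def)
  qed
  have FE: "F n \<subseteq> E" for n by (auto simp: F_def)
  obtain \<mu> :: "(real ^ 'n) set \<Rightarrow> real"
    where add: "Measure_Space.additive (sets lborel) \<mu>"
    and ge0: "\<And>A. 0 \<le> \<mu> A" and le1: "\<And>A. \<mu> A \<le> 1"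
    and null: "\<And>A. A \<in> sets lborel \<Longrightarrow> emeasure lborel A = 0 \<Longrightarrow> \<mu> A = 0"
    and one: "\<And>A n. F n \<subseteq> A \<Longrightarrow> \<mu> A = 1" and zero: "\<And>A n. A \<inter> F n = {} \<Longrightarrow> \<mu> A = 0"
    by (rule lborel.finitely_additive_limit[OF FB Fpos Fdec]) blast
  have add': "Measure_Space.additive (borel_subsets \<Omega>) \<mu>"
    using add by (auto simp: Measure_Space.additive_def bs)
  have tv: "total_var \<Omega> \<mu> A = \<mu> A" if "A \<in> sets borel" "A \<subseteq> \<Omega>" for A
    using total_var_nonneg[OF add' ge0] that bs by blast
  \<comment> \<open>Points of \<open>F n\<close> have norm above \<open>1 / d n\<close>, which is
    \<open>n + 1\<close>. Hence every bounded set misses some \<open>F n\<close>.\<close>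
  have far: "\<exists>n. \<forall>y\<in>F n. norm y > b" for b
  proof -
    obtain n where "b < real n" using reals_Archimedean2 by blast
    then have "norm y > b" if "y \<in> F n" for y
      using that by (simp add: F_def ball_infty_def d_def image_iff inverse_eq_divide)
    then show ?thesis by blast
  qed
  have "\<mu> \<in> Dens \<Omega> C"
    unfolding Dens_def ba_space_def
  proof (intro CollectI conjI allI impI ballI)
    show "bounded (\<mu> ` borel_subsets \<Omega>)"
      using ge0 le1 by (intro boundedI[of _ 1]) auto
    show \<Omega>1: "\<mu> \<Omega> = 1"
      using FE[of 0] assms(3) by (intro one[of 0]) blast
    fix \<delta> :: real assume "\<delta> > 0"
    then obtain n where "d n < \<delta>"
      unfolding d_def using reals_Archimedean by blast
    then have "F n \<subseteq> Some -` nbhd C \<delta> \<inter> \<Omega>"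
      using nbhd_mono[OF d, of n \<delta> C] FE[of n] assms(3) by (auto simp: F_def)
    then show "\<mu> (Some -` nbhd C \<delta> \<inter> \<Omega>) = \<mu> \<Omega>"
      using one \<Omega>1 by simp
  qed (use add' ge0 null bs in auto)
  moreover have "core \<Omega> \<mu> = {None}"
  proof (intro equalityI subsetI)
    fix x assume x: "x \<in> core \<Omega> \<mu>"
    show "x \<in> {None}"
    proof (cases x)
      case (Some y)
      \<comment> \<open>The unit ball around a finite point is a bounded neighborhood, so
        \<open>\<mu>\<close> vanishes on its trace and the point is not in the core.\<close>
      have "openin cpt_space (Some ` ball y 1)"
        by (auto simp: openin_Alexandroff_compactification)
      then have "total_var \<Omega> \<mu> (Some -` Some ` ball y 1 \<inter> \<Omega>) > 0"
        using x Some unfolding core_def by auto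
      then have "\<mu> (ball y 1 \<inter> \<Omega>) > 0"
        using tv[of "ball y 1 \<inter> \<Omega>"] assms(1) by (simp add: inj_vimage_image_eq)
      moreover obtain n where n: "\<forall>z\<in>F n. norm z > norm y + 1" using far by blast
      have "(ball y 1 \<inter> \<Omega>) \<inter> F n = {}"
      proof -
        have "norm z < norm y + 1" if "z \<in> ball y 1" for z
          using that norm_triangle_ineq2[of z y] by (simp add: dist_norm norm_minus_commute)
        then show ?thesis using n by force
      qed
      ultimately show ?thesis using zero by force
    qed simp
  next
    fix x :: "(real ^ 'n) option" assume "x \<in> {None}"
    then have x: "x = None" by simp
    have "total_var \<Omega> \<mu> (Some -` U \<inter> \<Omega>) > 0" if U: "openin cpt_space U" "None \<in> U" for U
    proof -
      \<comment> \<open>An open set around infinity omits only a compact \<open>K\<close>. Some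
        \<open>F n\<close> avoids \<open>K\<close>, so the trace of \<open>U\<close> has full
        mass.\<close>
      obtain K where K: "compact K" "closed K" "U = insert None (Some ` (UNIV - K))"
        using U by (auto simp: openin_Alexandroff_compactification)
      then have eq: "Some -` U = - K" by auto
      obtain b where b: "\<forall>z\<in>K. norm z \<le> b"
        using compact_imp_bounded[OF K(1)] by (auto simp: bounded_iff)
      obtain n where "\<forall>z\<in>F n. norm z > b" using far by blast
      then have "F n \<subseteq> - K \<inter> \<Omega>" using b FE[of n] assms(3) by force
      then have "\<mu> (- K \<inter> \<Omega>) = 1" by (rule one)
      then show ?thesis
        using tv[of "- K \<inter> \<Omega>"] K(2) assms(1) eq by simp
    qed
    then show "x \<in> core \<Omega> \<mu>" using x by (simp add: core_def)
  qed
  moreover have "is_aura \<Omega> \<mu> E"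
    unfolding is_aura_def
  proof
    show "E \<in> borel_subsets \<Omega>" using assms(3,4) bs by blast
    have "(\<Omega> - E) \<inter> F 0 = {}" using FE[of 0] by blast
    then have "\<mu> (\<Omega> - E) = 0" by (rule zero)
    then show "total_var \<Omega> \<mu> (\<Omega> - E) = 0"
      using tv[of "\<Omega> - E"] assms(1,4) by auto
  qed
  ultimately show ?thesis by blast
qed

end
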